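(* Let $I$ be a set, $\alpha : I \to I$ a function, and $k$ a natural number with $1 \le k \le |I|$. Consider the condition $$(\ast)\qquad \forall I^* \in \mathcal{P}_{\omega,k^+}(I) : \alpha(I^* ) \subseteq I^*.$$ (a) If $1 \le k < |I|$ and $\alpha$ satisfies $(\ast)$, then $\alpha = \mathrm{Id}_I$. (b) If $k = |I|$, then $\alpha$ can be arbitrary, i.e. every function $\alpha : I \to I$ satisfies $(\ast)$.
   Context: $|A|$ denotes the cardinality of a set $A$ (the set $I$ may be finite or infinite). For a natural number $k$, $\mathcal{P}_{\omega,k^+}(I) = \{B \subseteq I : k \le |B| < \infty\}$ is the set of finite subsets of $I$ having at least $k$ elements. *)

theory Defs
  imports "HOL-Library.Equipollence" "HOL-Library.FuncSet"
begin

(* Finiteness has to be required separately, because card is 0 on infinite sets. *)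
definition fin_subsets_ge :: "nat \<Rightarrow> 'a set \<Rightarrow> 'a set set" where
  "fin_subsets_ge k I = {B. B \<subseteq> I \<and> finite B \<and> k \<le> card B}"

definition preserves_fin_subsets_ge :: "nat \<Rightarrow> 'a set \<Rightarrow> ('a \<Rightarrow> 'a) \<Rightarrow> bool" where
  "preserves_fin_subsets_ge k I \<alpha> \<longleftrightarrow> (\<forall>B \<in> fin_subsets_ge k I. \<alpha> ` B \<subseteq> B)"

end

theory Submission
  imports Defs
begin

text \<open>If \<alpha> moves a point i, then a finite set of at least k elements that contains i
  but misses \<alpha> i violates the condition. When k < |I| there is room for such a set, by
  \<open>obtain_finite_subset_avoiding\<close>. When |I| = k, the only admissible set is I itself,
  and the condition merely says that \<alpha> maps I into I. Sizes are compared with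
  \<open>{..<k}\<close> by equipollence, so that infinite I is covered too.\<close>

lemma lesspoll_imp_card_less:
  assumes "A \<prec> B" "finite B"
  shows "card A < card B"
proof -
  have le: "A \<lesssim> B" and ne: "\<not> A \<approx> B"
    using assms(1) by (simp_all add: lesspoll_def)
  have "finite A"
    using le assms(2) by (auto simp: lepoll_def dest: inj_on_finite)
  then show ?thesis
    using le ne assms(2) by (simp add: lepoll_iff_card_le eqpoll_iff_card)
qed

text \<open>The set consists of x and k - 1 further points chosen outside {x, y}; infinite I offers
  these at once, finite I by counting.\<close>

lemma obtain_finite_subset_avoiding:
  fixes k :: nat
  assumes "{..<k} \<prec> I" "1 \<le> k" "x \<in> I" "x \<noteq> y"
  obtains B where "B \<in> fin_subsets_ge k I" "x \<in> B" "y \<notin> B"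
proof -
  have "\<exists>C. finite C \<and> card C = k - 1 \<and> C \<subseteq> I - {x, y}"
  proof (cases "finite I")
    case True
    then have "k < card I"
      using lesspoll_imp_card_less[OF assms(1)] by simp
    moreover have "card I - card {x, y} \<le> card (I - {x, y})"
      by (rule diff_card_le_card_Diff) simp
    \<comment> \<open>Strictness matters here: |I| is at least k + 1, so deleting two points leaves
      at least k - 1.\<close>
    ultimately have "k - 1 \<le> card (I - {x, y})"
      using assms(4) by simp
    then show ?thesis
      by (metis obtain_subset_with_card_n)
  next
    case False
    then show ?thesis
      by (intro infinite_arbitrarily_large) simp
  qed
  then obtain C where C: "finite C" "card C = k - 1" "C \<subseteq> I - {x, y}"
    by blast
  \<comment> \<open>Since 1 \<le> k, the subtraction in k - 1 is not truncated.\<close>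
  moreover from C have "card (insert x C) = k"
    using assms(2) by (subst card_insert_disjoint) auto
  ultimately have "insert x C \<in> fin_subsets_ge k I"
    using assms(3) by (auto simp: fin_subsets_ge_def)
  then show thesis
    using that[of "insert x C"] C(3) assms(4) by blast
qed

theorem proposition4p1:
  fixes I :: "'a set" and \<alpha> :: "'a \<Rightarrow> 'a" and k :: nat
  assumes "\<alpha> \<in> I \<rightarrow> I"
    and "1 \<le> k"
    and "{..<k} \<lesssim> I"
  shows "({..<k} \<prec> I \<and> preserves_fin_subsets_ge k I \<alpha> \<longrightarrow> (\<forall>i\<in>I. \<alpha> i = i))
       \<and> ({..<k} \<approx> I \<longrightarrow> preserves_fin_subsets_ge k I \<alpha>)"
proof (intro conjI impI ballI)
  fix i
  assume *: "{..<k} \<prec> I \<and> preserves_fin_subsets_ge k I \<alpha>" and "i \<in> I"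
  show "\<alpha> i = i"
  proof (rule ccontr)
    assume "\<alpha> i \<noteq> i"
    then obtain B where "B \<in> fin_subsets_ge k I" "i \<in> B" "\<alpha> i \<notin> B"
      using obtain_finite_subset_avoiding * assms(2) \<open>i \<in> I\<close> by metis
    then show False
      using * by (auto simp: preserves_fin_subsets_ge_def)
  qed
next
  assume "{..<k} \<approx> I"
  then have I: "finite I" "card I = k"
    using eqpoll_finite_iff[of "{..<k}" I] eqpoll_iff_card[of "{..<k}" I] by auto
  \<comment> \<open>A subset of a finite set with at least as many elements is the whole
    set.\<close>
  have "B = I" if "B \<in> fin_subsets_ge k I" for B
    using that I by (auto simp: fin_subsets_ge_def dest: card_seteq)
  then show "preserves_fin_subsets_ge k I \<alpha>"
    using assms(1) by (auto simp: preserves_fin_subsets_ge_def)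
qed

end
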